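(* Let $n,k\in\mathbb{N}_0$ with $n\ge k$ and let $m\in\mathbb{N}$. Let $P_1(x_1),\ldots,P_m(x_m)$ and $Q_0(x_0),\ldots,Q_k(x_k)$ be polynomials. Then $$\mathbb{S}_n\left(P(\overrightarrow{X_m});Q(\overrightarrow{X_k})\right)=\sum_{j=0}^{k}Q_j(x_j)\,\mathbb{Y}_{n-j}\left(P(\overrightarrow{X_m})\right).$$
   Context: $\mathbb{N}=\{1,2,\ldots\}$ and $\mathbb{N}_0=\{0,1,2,\ldots\}$. For $m\in\mathbb{N}$ and $k\in\mathbb{N}_0$, the $P_j(x_j)$ ($1\le j\le m$) and $Q_l(x_l)$ ($0\le l\le k$) are arbitrary polynomials (say with complex coefficients) in the indicated variables. Write $P(\overrightarrow{X_m})=(P_1(x_1),\ldots,P_m(x_m))$ and $Q(\overrightarrow{X_k})=(Q_0(x_0),Q_1(x_1),\ldots,Q_k(x_k))$. The polynomials $\mathbb{Y}_n$ and $\mathbb{S}_n$, $n\ge 0$, are defined by the power series expansions in $w$ $$\frac{1}{1+\sum_{j=1}^{m}P_j(x_j)w^j}=\sum_{n=0}^{\infty}\mathbb{Y}_n\left(P(\overrightarrow{X_m})\right)w^n,\qquad \frac{\sum_{j=0}^{k}Q_j(x_j)w^j}{1+\sum_{j=1}^{m}P_j(x_j)w^j}=\sum_{n=0}^{\infty}\mathbb{S}_n\left(P(\overrightarrow{X_m});Q(\overrightarrow{X_k})\right)w^n.$$ *)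

theory Defs
  imports
    "HOL-Library.Poly_Mapping"
    "HOL-Computational_Algebra.Polynomial"
    "HOL-Computational_Algebra.Formal_Power_Series"
begin

text \<open>
  Complex polynomials in the variables \<open>x\<^sub>0, x\<^sub>1, x\<^sub>2, \<dots>\<close>: a monomial is a finitely supported
  exponent vector, and a polynomial is a finitely supported family of coefficients.  The ring
  structure (convolution product) is the one of \<^theory>\<open>HOL-Library.Poly_Mapping\<close>.
\<close>

type_synonym cmpoly = "(nat \<Rightarrow>\<^sub>0 nat) \<Rightarrow>\<^sub>0 complex"

definition const_mp :: "complex \<Rightarrow> cmpoly" where
  "const_mp c = Poly_Mapping.single 0 c"

definition var_mp :: "nat \<Rightarrow> cmpoly" where
  "var_mp j = Poly_Mapping.single (Poly_Mapping.single j 1) 1"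

text \<open>The univariate polynomial \<open>p\<close> in the variable \<open>x\<^sub>j\<close>, i.e. \<open>p(x\<^sub>j)\<close>.\<close>

definition in_var :: "complex poly \<Rightarrow> nat \<Rightarrow> cmpoly" where
  "in_var p j = poly (map_poly const_mp p) (var_mp j)"

text \<open>
  Quotient \<open>F / D\<close> of formal power series over a commutative ring.  The division of the library
  needs an inverse operation on the coefficients, which polynomials lack; here it is only used for
  \<open>D\<close> with constant term \<open>1\<close>, where the quotient exists and is unique (shown next).
\<close>

definition fps_quot :: "'a::comm_ring_1 fps \<Rightarrow> 'a fps \<Rightarrow> 'a fps" where
  "fps_quot F D = (THE G. D * G = F)"

lemma fps_quot_ex1:
  fixes F D :: "'a::comm_ring_1 fps"
  assumes "fps_nth D 0 = 1"
  shows "\<exists>!G. D * G = F"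
proof -
  define E where "E = fps_right_inverse D 1"
  have E: "D * E = 1"
    unfolding E_def by (rule fps_right_inverse) (simp add: assms)
  show ?thesis
  proof
    show "D * (E * F) = F"
      by (simp add: E flip: mult.assoc)
    show "G = E * F" if "D * G = F" for G
      using that E by (metis mult.assoc mult.commute mult_1)
  qed
qed

text \<open>
  The common denominator and the numerator, as power series in \<open>w\<close>.  Only the entries
  \<open>P 1, \<dots>, P m\<close> and \<open>Q 0, \<dots>, Q k\<close> of the families are used.
\<close>

definition denom_series :: "nat \<Rightarrow> (nat \<Rightarrow> complex poly) \<Rightarrow> cmpoly fps" where
  "denom_series m P = 1 + (\<Sum>j=1..m. fps_const (in_var (P j) j) * fps_X ^ j)"

definition numer_series :: "nat \<Rightarrow> (nat \<Rightarrow> complex poly) \<Rightarrow> cmpoly fps" where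
  "numer_series k Q = (\<Sum>j=0..k. fps_const (in_var (Q j) j) * fps_X ^ j)"

lemma denom_series_nth_0: "fps_nth (denom_series m P) 0 = 1"
  by (simp add: denom_series_def fps_sum_nth)

definition Y_poly :: "nat \<Rightarrow> (nat \<Rightarrow> complex poly) \<Rightarrow> nat \<Rightarrow> cmpoly" where
  "Y_poly m P n = fps_nth (fps_quot 1 (denom_series m P)) n"

definition S_poly ::
  "nat \<Rightarrow> (nat \<Rightarrow> complex poly) \<Rightarrow> nat \<Rightarrow> (nat \<Rightarrow> complex poly) \<Rightarrow> nat \<Rightarrow> cmpoly" where
  "S_poly m P k Q n = fps_nth (fps_quot (numer_series k Q) (denom_series m P)) n"

end

theory Submission
  imports Defs
begin

text \<open>
  Since the denominator \<open>D\<close> has constant term \<open>1\<close>, it is invertible in the ring of power series, and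
  dividing a series by \<open>D\<close> is the same as multiplying it by \<open>1 / D\<close>, the generating series of the
  \<open>Y\<close>-polynomials (lemma \<open>fps_quot_eq_mult\<close>).  Hence the generating series of the \<open>S\<close>-polynomials is
  the product of \<open>\<Sum>j\<le>k. Q\<^sub>j w\<^sup>j\<close> with that of the \<open>Y\<close>-polynomials.  Multiplication by \<open>w\<^sup>j\<close> shifts
  coefficients by \<open>j\<close>, and as \<open>j \<le> k \<le> n\<close> every shifted index \<open>n - j\<close> is a genuine one, so no summand
  drops out of the \<open>n\<close>-th coefficient.
\<close>

lemma mult_fps_quot:
  fixes F D :: "'a::comm_ring_1 fps"
  assumes "fps_nth D 0 = 1"
  shows "D * fps_quot F D = F"
  unfolding fps_quot_def by (rule theI' [OF fps_quot_ex1 [OF assms]])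

lemma fps_quot_unique:
  fixes F D G :: "'a::comm_ring_1 fps"
  assumes "fps_nth D 0 = 1" and "D * G = F"
  shows "fps_quot F D = G"
  using fps_quot_ex1 [OF assms(1)] mult_fps_quot [OF assms(1)] assms(2) by blast

text \<open>
  Multiplying \<open>F * (1 / D)\<close> by \<open>D\<close> gives \<open>F\<close>, a property that characterises \<open>F / D\<close>.
\<close>

lemma fps_quot_eq_mult:
  fixes F D :: "'a::comm_ring_1 fps"
  assumes "fps_nth D 0 = 1"
  shows "fps_quot F D = F * fps_quot 1 D"
proof (rule fps_quot_unique [OF assms])
  show "D * (F * fps_quot 1 D) = F"
    by (simp add: mult.left_commute [of D] mult_fps_quot [OF assms])
qed

lemma fps_nth_polynomial_mult:
  fixes c :: "nat \<Rightarrow> 'a::comm_ring_1" and G :: "'a fps"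
  assumes "k \<le> n"
  shows "fps_nth ((\<Sum>j=0..k. fps_const (c j) * fps_X ^ j) * G) n
           = (\<Sum>j=0..k. c j * fps_nth G (n - j))"
  using assms
  by (auto simp: sum_distrib_right fps_sum_nth mult.assoc fps_X_power_mult_nth intro!: sum.cong)

theorem theorem9:
  fixes n k m :: nat
    and P Q :: "nat \<Rightarrow> complex poly"
  assumes "n \<ge> k" and "m \<ge> 1"
  shows "S_poly m P k Q n = (\<Sum>j=0..k. in_var (Q j) j * Y_poly m P (n - j))"
proof -
  have "S_poly m P k Q n = fps_nth (numer_series k Q * fps_quot 1 (denom_series m P)) n"
    by (simp only: S_poly_def fps_quot_eq_mult [OF denom_series_nth_0, of "numer_series k Q"])
  also have "\<dots> = (\<Sum>j=0..k. in_var (Q j) j * Y_poly m P (n - j))"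
    unfolding numer_series_def Y_poly_def by (rule fps_nth_polynomial_mult [OF assms(1)])
  finally show ?thesis .
qed

end
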